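(* Let $G$ be a non-locally finite group. (a) For every infinite set $A$, there exists a (finite-memory) cellular automaton $\tau\colon A^G\to A^G$ whose image $\tau(A^G)$ is not closed in $A^G$ in the prodiscrete topology. (b) For every field $K$ and every infinite-dimensional $K$-vector space $V$, there exists a (finite-memory) linear cellular automaton $\tau\colon V^G\to V^G$ whose image $\tau(V^G)$ is not closed in $V^G$ in the prodiscrete topology.
   Context: We work in ZFC. A group is locally finite if every finitely generated subgroup of it is finite. For a group $G$ and a set $A$, $A^G$ is the set of all maps $G\to A$, with the prodiscrete topology: the product topology obtained by giving each factor $A$ the discrete topology. The group $G$ acts on $A^G$ by $(gx)(h)=x(g^{-1}h)$. A map $\tau\colon A^G\to A^G$ is a cellular automaton if there exist a finite subset $M\subset G$ (a memory set) and a map $\mu\colon A^M\to A$ (local defining map) such that $\tau(x)(g)=\mu((g^{-1}x)|_M)$ for all $x\in A^G$, $g\in G$; note $(g^{-1}x)(m)=x(gm)$. If $A=V$ is a vector space over a field $K$ and $\mu\colon V^M\to V$ can be taken $K$-linear, then $\tau$ is called a linear cellular automaton. Every cellular automaton has finite memory by definition. *)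

theory Defs
  imports "HOL-Analysis.Function_Topology" "HOL-Algebra.Generated_Groups"
begin

definition finitely_generated_subgroup :: "'g set \<Rightarrow> ('g, 'm) monoid_scheme \<Rightarrow> bool" where
  "finitely_generated_subgroup H G \<longleftrightarrow>
     subgroup H G \<and> (\<exists>S. finite S \<and> S \<subseteq> carrier G \<and> H = generate G S)"

definition locally_finite_group :: "('g, 'm) monoid_scheme \<Rightarrow> bool" where
  "locally_finite_group G \<longleftrightarrow> group G \<and> (\<forall>H. finitely_generated_subgroup H G \<longrightarrow> finite H)"

text \<open>
  The set \<open>A\<^sup>X\<close> of all maps from a set \<open>X\<close> to a set \<open>A\<close> is rendered as the extensional function
  space \<open>X \<rightarrow>\<^sub>E A\<close>: a map is represented by a total function with the value \<^const>\<open>undefined\<close>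
  outside \<open>X\<close>, so that two maps are equal iff they agree on \<open>X\<close>.
\<close>

abbreviation configs :: "('g, 'm) monoid_scheme \<Rightarrow> 'a set \<Rightarrow> ('g \<Rightarrow> 'a) set" where
  "configs G A \<equiv> carrier G \<rightarrow>\<^sub>E A"

definition prodiscrete_topology :: "('g, 'm) monoid_scheme \<Rightarrow> 'a set \<Rightarrow> ('g \<Rightarrow> 'a) topology" where
  "prodiscrete_topology G A = product_topology (\<lambda>_. discrete_topology A) (carrier G)"

definition shift :: "('g, 'm) monoid_scheme \<Rightarrow> 'g \<Rightarrow> ('g \<Rightarrow> 'a) \<Rightarrow> ('g \<Rightarrow> 'a)" where
  "shift G g x = (\<lambda>h\<in>carrier G. x (inv\<^bsub>G\<^esub> g \<otimes>\<^bsub>G\<^esub> h))"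

definition has_local_map ::
  "('g, 'm) monoid_scheme \<Rightarrow> 'a set \<Rightarrow> (('g \<Rightarrow> 'a) \<Rightarrow> ('g \<Rightarrow> 'a)) \<Rightarrow> 'g set \<Rightarrow> (('g \<Rightarrow> 'a) \<Rightarrow> 'a) \<Rightarrow> bool"
  where
  "has_local_map G A \<tau> M \<mu> \<longleftrightarrow>
     finite M \<and> M \<subseteq> carrier G \<and> \<mu> \<in> (M \<rightarrow>\<^sub>E A) \<rightarrow> A \<and>
     (\<forall>x\<in>configs G A. \<forall>g\<in>carrier G. \<tau> x g = \<mu> (restrict (shift G (inv\<^bsub>G\<^esub> g) x) M))"

definition cellular_automaton ::
  "('g, 'm) monoid_scheme \<Rightarrow> 'a set \<Rightarrow> (('g \<Rightarrow> 'a) \<Rightarrow> ('g \<Rightarrow> 'a)) \<Rightarrow> bool" where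
  "cellular_automaton G A \<tau> \<longleftrightarrow>
     \<tau> \<in> configs G A \<rightarrow> configs G A \<and> (\<exists>M \<mu>. has_local_map G A \<tau> M \<mu>)"

text \<open>
  Linearity of a map \<open>V\<^sup>M \<rightarrow> V\<close> for the pointwise vector space structure on \<open>V\<^sup>M\<close>. The pointwise
  operations are restricted to \<open>M\<close> in order to stay inside the extensional function space.
\<close>

definition linear_on_power ::
  "('k::field \<Rightarrow> 'v::ab_group_add \<Rightarrow> 'v) \<Rightarrow> 'g set \<Rightarrow> (('g \<Rightarrow> 'v) \<Rightarrow> 'v) \<Rightarrow> bool" where
  "linear_on_power smul M \<mu> \<longleftrightarrow>
     (\<forall>y\<in>M \<rightarrow>\<^sub>E UNIV. \<forall>z\<in>M \<rightarrow>\<^sub>E UNIV. \<mu> (\<lambda>m\<in>M. y m + z m) = \<mu> y + \<mu> z) \<and>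
     (\<forall>c. \<forall>y\<in>M \<rightarrow>\<^sub>E UNIV. \<mu> (\<lambda>m\<in>M. smul c (y m)) = smul c (\<mu> y))"

definition linear_cellular_automaton ::
  "('g, 'm) monoid_scheme \<Rightarrow> ('k::field \<Rightarrow> 'v::ab_group_add \<Rightarrow> 'v)
     \<Rightarrow> (('g \<Rightarrow> 'v) \<Rightarrow> ('g \<Rightarrow> 'v)) \<Rightarrow> bool" where
  "linear_cellular_automaton G smul \<tau> \<longleftrightarrow>
     \<tau> \<in> configs G UNIV \<rightarrow> configs G UNIV \<and>
     (\<exists>M \<mu>. has_local_map G UNIV \<tau> M \<mu> \<and> linear_on_power smul M \<mu>)"

definition infinite_dimensional :: "('k::field \<Rightarrow> 'v::ab_group_add \<Rightarrow> 'v) \<Rightarrow> bool" where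
  "infinite_dimensional smul \<longleftrightarrow>
     vector_space smul \<and> (\<nexists>B. finite_dimensional_vector_space smul B)"

end

theory Submission
  imports Defs
begin

text \<open>
  A group that is not locally finite contains a finite set \<open>S\<close> whose words represent infinitely many
  elements, so every finite \<open>F\<close> can be left by an \<open>S\<close>-walk from any starting point.

  (a) Read a symbol as a pair \<open>(n, s)\<close> of a rank and a direction \<open>s \<in> S\<close>, and let the automaton test at
  each \<open>g\<close> whether the rank at \<open>g s\<close> is smaller than the rank at \<open>g\<close>. Passing the test everywhere
  would be an infinite descent, but on a finite \<open>F\<close> it is passed by the distance to the complement
  of \<open>F\<close>.

  (b) Choose words \<open>w\<^sub>n\<close> with pairwise distinct endpoints \<open>h\<^sub>n\<close> and linearly independent vectors
  \<open>e\<^sub>n\<^sub>,\<^sub>i\<close> for \<open>i \<le> |w\<^sub>n|\<close>, and take \<open>\<tau>(x)(g) = x(g) - (\<Sum>s\<in>S. T\<^sub>s(x(gs)))\<close>, where \<open>T\<^sub>s\<close> lowers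
  \<open>e\<^sub>n\<^sub>,\<^sub>i\<^sub>+\<^sub>1\<close> to \<open>e\<^sub>n\<^sub>,\<^sub>i\<close> if \<open>s\<close> is the \<open>i\<close>-th letter of \<open>w\<^sub>n\<close>. If \<open>y\<close> is the top vector of the \<open>n\<close>-th
  chain at \<open>h\<^sub>n\<close> and zero elsewhere, any preimage of \<open>y\<close> transports the coefficient 1 back
  along \<open>w\<^sub>n\<close> to the coefficient of \<open>e\<^sub>n\<^sub>,\<^sub>0\<close> at the identity, for all \<open>n\<close> at once. A finite set
  contains only finitely many \<open>h\<^sub>n\<close>, and there the finitely many chains add up to a local preimage.
\<close>

text \<open>A basic open neighbourhood of \<open>y\<close> constrains only finitely many
  coordinates, so a point of \<open>X\<close> that agrees with \<open>y\<close> on those already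
  lies in it.\<close>

lemma not_closedin_prodiscreteI:
  assumes "y \<in> configs G A" "y \<notin> X"
    and approx: "\<And>F. finite F \<Longrightarrow> F \<subseteq> carrier G \<Longrightarrow> \<exists>x\<in>X. x \<in> configs G A \<and> (\<forall>g\<in>F. x g = y g)"
  shows "\<not> closedin (prodiscrete_topology G A) X"
proof
  assume "closedin (prodiscrete_topology G A) X"
  moreover have top: "topspace (prodiscrete_topology G A) = configs G A"
    by (simp add: prodiscrete_topology_def)
  ultimately have "openin (prodiscrete_topology G A) (configs G A - X)"
    by (metis closedin_def)
  with assms(1,2) have "\<exists>U. finite {i \<in> carrier G. U i \<noteq> topspace (discrete_topology A)} \<and>
      (\<forall>i\<in>carrier G. openin (discrete_topology A) (U i)) \<and>
      y \<in> Pi\<^sub>E (carrier G) U \<and> Pi\<^sub>E (carrier G) U \<subseteq> configs G A - X"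
    unfolding prodiscrete_topology_def openin_product_topology_alt by (elim bspec) blast
  then obtain U where "finite {i \<in> carrier G. U i \<noteq> topspace (discrete_topology A)}"
    and U: "y \<in> Pi\<^sub>E (carrier G) U" "Pi\<^sub>E (carrier G) U \<subseteq> configs G A - X"
    by (elim exE conjE)
  then have "finite {i \<in> carrier G. U i \<noteq> A}" by simp
  from approx[OF this] obtain x where x: "x \<in> X" "x \<in> configs G A"
      "\<And>g. g \<in> carrier G \<Longrightarrow> U g \<noteq> A \<Longrightarrow> x g = y g"
    by auto
  have "x \<in> Pi\<^sub>E (carrier G) U"
  proof (rule PiE_I)
    fix g assume g: "g \<in> carrier G"
    show "x g \<in> U g"
    proof (cases "U g = A")
      case True
      then show ?thesis using PiE_mem[OF x(2) g] by simp
    next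
      case False
      then show ?thesis using PiE_mem[OF U(1) g] x(3)[OF g] by simp
    qed
  qed (rule PiE_arb[OF x(2)])
  with U(2) x(1) show False by blast
qed

section \<open>Words and walks in a group that is not locally finite\<close>

context group
begin

abbreviation walk :: "'a \<Rightarrow> 'a list \<Rightarrow> 'a" where
  "walk \<equiv> foldl (\<otimes>)"

lemma walk_closed: "g \<in> carrier G \<Longrightarrow> set w \<subseteq> carrier G \<Longrightarrow> walk g w \<in> carrier G"
  by (induction w arbitrary: g) auto

lemma walk_eq_mult:
  "g \<in> carrier G \<Longrightarrow> set w \<subseteq> carrier G \<Longrightarrow> walk g w = g \<otimes> walk \<one> w"
proof (induction w arbitrary: g)
  case (Cons s w)
  then have "walk (g \<otimes> s) w = (g \<otimes> s) \<otimes> walk \<one> w"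
    by (intro Cons.IH) simp_all
  also have "\<dots> = g \<otimes> (s \<otimes> walk \<one> w)"
    using Cons.prems by (simp add: m_assoc walk_closed)
  also have "s \<otimes> walk \<one> w = walk s w"
    using Cons.prems by (intro Cons.IH[symmetric]) simp_all
  finally show ?case using Cons.prems by simp
qed simp

lemma walk_generate:
  assumes "S \<subseteq> carrier G" "h \<in> generate G S"
  shows "\<exists>w\<in>lists (S \<union> m_inv G ` S). h = walk \<one> w"
  using assms(2)
proof induction
  case one
  show ?case by (rule bexI[of _ "[]"]) auto
next
  case (incl h)
  with assms show ?case by (intro bexI[of _ "[h]"]) auto
next
  case (inv h)
  with assms show ?case by (intro bexI[of _ "[inv h]"]) auto
next
  case (eng h1 h2)
  then obtain w1 w2 where w: "w1 \<in> lists (S \<union> m_inv G ` S)" "h1 = walk \<one> w1"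
      "w2 \<in> lists (S \<union> m_inv G ` S)" "h2 = walk \<one> w2" by blast
  have "S \<union> m_inv G ` S \<subseteq> carrier G" using assms(1) by auto
  then have sub: "set w1 \<subseteq> carrier G" "set w2 \<subseteq> carrier G"
    using w(1,3) unfolding lists_eq_set by blast+
  have "walk \<one> (w1 @ w2) = walk h1 w2" by (simp add: w(2))
  also have "\<dots> = h1 \<otimes> h2"
    unfolding w(4) using sub by (intro walk_eq_mult) (simp_all add: w(2) walk_closed)
  finally have "walk \<one> (w1 @ w2) = h1 \<otimes> h2" .
  then show ?case
    using w(1,3) by (intro bexI[of _ "w1 @ w2"]) (simp_all only: append_in_lists_conv simp_thms)
qed

text \<open>Adding the inverses to a finite generating set of an infinite subgroup makes every
  element of that subgroup the endpoint of a walk.\<close>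

lemma infinite_walks:
  assumes "\<not> locally_finite_group G"
  obtains S where "finite S" "S \<subseteq> carrier G" "infinite (walk \<one> ` lists S)"
proof -
  obtain S where S: "finite S" "S \<subseteq> carrier G" "infinite (generate G S)"
    using assms is_group by (auto simp: locally_finite_group_def finitely_generated_subgroup_def)
  have "generate G S \<subseteq> walk \<one> ` lists (S \<union> m_inv G ` S)"
    using walk_generate[OF S(2)] by blast
  then have "infinite (walk \<one> ` lists (S \<union> m_inv G ` S))"
    using S(3) finite_subset by blast
  with S show ?thesis
    by (intro that[of "S \<union> m_inv G ` S"]) auto
qed

text \<open>Left translation by \<open>g\<close> is injective, so walks from \<open>g\<close> have
  as many endpoints as walks from \<open>\<one>\<close>: too many for \<open>F\<close>.\<close>

lemma walk_leaves_finite: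
  assumes "S \<subseteq> carrier G" "infinite (walk \<one> ` lists S)" "finite F" "g \<in> carrier G"
  shows "\<exists>w\<in>lists S. walk g w \<notin> F"
proof (rule ccontr)
  assume *: "\<not> ?thesis"
  have "(\<otimes>) g ` walk \<one> ` lists S \<subseteq> F"
  proof (unfold image_image, rule image_subsetI)
    fix w assume w: "w \<in> lists S"
    then have "set w \<subseteq> carrier G" using assms(1) by (simp add: lists_eq_set)
    then have "g \<otimes> walk \<one> w = walk g w"
      using assms(4) by (intro walk_eq_mult[symmetric])
    moreover have "walk g w \<in> F" using * w by blast
    ultimately show "g \<otimes> walk \<one> w \<in> F" by simp
  qed
  then have "finite ((\<otimes>) g ` walk \<one> ` lists S)"
    using assms(3) finite_subset by blast
  moreover have "inj_on ((\<otimes>) g) (walk \<one> ` lists S)"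
  proof (rule inj_on_subset)
    show "inj_on ((\<otimes>) g) (carrier G)" using assms(4) by (simp add: inj_on_def)
    show "walk \<one> ` lists S \<subseteq> carrier G"
      using assms(1) walk_closed by (auto simp: lists_eq_set)
  qed
  ultimately show False using assms(2) finite_imageD by blast
qed

text \<open>Because (g^{-1}x)(m) = x(gm), this is the automaton given by \<open>M\<close> and
  \<open>\<mu>\<close>, with the shift already evaluated.\<close>

definition induced_map :: "'a set \<Rightarrow> (('a \<Rightarrow> 'c) \<Rightarrow> 'c) \<Rightarrow> ('a \<Rightarrow> 'c) \<Rightarrow> 'a \<Rightarrow> 'c" where
  "induced_map M \<mu> x = (\<lambda>g\<in>carrier G. \<mu> (\<lambda>m\<in>M. x (g \<otimes> m)))"

lemma induced_map:
  assumes "finite M" "M \<subseteq> carrier G" "\<mu> \<in> (M \<rightarrow>\<^sub>E A) \<rightarrow> A"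
  shows "induced_map M \<mu> \<in> configs G A \<rightarrow> configs G A"
    and "has_local_map G A (induced_map M \<mu>) M \<mu>"
proof -
  have "(\<lambda>m\<in>M. x (g \<otimes> m)) \<in> M \<rightarrow>\<^sub>E A" if "x \<in> configs G A" "g \<in> carrier G" for x g
  proof (rule restrict_PiE_iff[THEN iffD2], rule ballI)
    fix m assume "m \<in> M"
    then show "x (g \<otimes> m) \<in> A"
      using assms(2) that by (intro PiE_mem[OF that(1)] m_closed) (simp_all add: subsetD)
  qed
  then have "\<mu> (\<lambda>m\<in>M. x (g \<otimes> m)) \<in> A" if "x \<in> configs G A" "g \<in> carrier G" for x g
    using assms(3) that by (simp add: Pi_iff)
  then show "induced_map M \<mu> \<in> configs G A \<rightarrow> configs G A"
    by (simp add: induced_map_def)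
  have "restrict (shift G (inv g) x) M = (\<lambda>m\<in>M. x (g \<otimes> m))" if "g \<in> carrier G" for x :: "'a \<Rightarrow> 'c" and g
    using that assms(2) by (intro restrict_ext) (simp add: shift_def subset_iff)
  then show "has_local_map G A (induced_map M \<mu>) M \<mu>"
    using assms by (simp add: has_local_map_def induced_map_def)
qed

section \<open>Arbitrary infinite alphabets\<close>

lemma ex_cellular_automaton_image_not_closed:
  fixes A :: "'c set"
  assumes "\<not> locally_finite_group G" "infinite A"
  shows "\<exists>\<tau>. cellular_automaton G A \<tau> \<and> \<not> closedin (prodiscrete_topology G A) (\<tau> ` configs G A)"
proof -
  obtain S where S: "finite S" "S \<subseteq> carrier G" "infinite (walk \<one> ` lists S)"
    using infinite_walks[OF assms(1)] .
  obtain f :: "nat \<Rightarrow> 'c" where f: "inj f" "range f \<subseteq> A"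
    using infinite_countable_subset[OF assms(2)] by blast
  define C :: "(nat \<times> 'a) set" where "C = UNIV \<times> S"
  have cC: "countable C" using S(1) by (simp add: C_def countable_finite)
  \<comment> \<open>Symbols outside the image of \<open>C\<close> under \<open>emb\<close> decode to
    an unspecified pair; hence \<open>\<mu>\<close> also tests whether \<open>dir\<close> lies in
    \<open>S\<close>.\<close>
  define emb where "emb = f \<circ> to_nat_on C"
  have emb: "inj_on emb C" "emb c \<in> A" for c
    using f inj_on_to_nat_on[OF cC] by (auto simp: emb_def intro!: comp_inj_on intro: inj_on_subset)
  define rank where "rank = fst \<circ> inv_into C emb"
  define dir where "dir = snd \<circ> inv_into C emb"
  have rd: "rank (emb (n, s)) = n" "dir (emb (n, s)) = s" if "s \<in> S" for n s
    using that emb(1) by (simp_all add: rank_def dir_def inv_into_f_f C_def)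
  have a: "f 0 \<in> A" "f 1 \<in> A" "f 0 \<noteq> f 1" using f by (auto simp: inj_eq)
  define M where "M = insert \<one> S"
  define \<mu> where "\<mu> y = (if dir (y \<one>) \<in> S \<and> rank (y (dir (y \<one>))) < rank (y \<one>) then f 1 else f 0)"
    for y :: "'a \<Rightarrow> 'c"
  define \<tau> where "\<tau> = induced_map M \<mu>"
  have M: "finite M" "M \<subseteq> carrier G" "\<mu> \<in> (M \<rightarrow>\<^sub>E A) \<rightarrow> A"
    using S a by (auto simp: M_def \<mu>_def)
  have ca: "cellular_automaton G A \<tau>"
    using induced_map[OF M] by (auto simp: cellular_automaton_def \<tau>_def)
  have \<tau>: "\<tau> x g = (if dir (x g) \<in> S \<and> rank (x (g \<otimes> dir (x g))) < rank (x g) then f 1 else f 0)"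
    if "g \<in> carrier G" for x g
    using that by (auto simp: \<tau>_def induced_map_def \<mu>_def M_def)
  \<comment> \<open>\<open>f 1\<close> marks a passed test, so \<open>y\<close> demands a pass
    everywhere.\<close>
  define y where "y = (\<lambda>g\<in>carrier G. f 1)"
  have "\<not> closedin (prodiscrete_topology G A) (\<tau> ` configs G A)"
  proof (rule not_closedin_prodiscreteI)
    show "y \<in> configs G A" using a by (auto simp: y_def)
    show "y \<notin> \<tau> ` configs G A"
    proof
      assume "y \<in> \<tau> ` configs G A"
      then obtain x where "y = \<tau> x" by blast
      then have "\<tau> x g = f 1" if "g \<in> carrier G" for g
        using that by (auto simp: y_def dest: fun_cong[where x = g])
      then have step: "dir (x g) \<in> S \<and> rank (x (g \<otimes> dir (x g))) < rank (x g)"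
        if "g \<in> carrier G" for g
        using \<tau>[OF that, of x] that a(3) by metis
      \<comment> \<open>Infinite descent as strong induction on the rank: an element of the carrier
        would have a neighbour of smaller rank, which the induction hypothesis excludes from the
        carrier.\<close>
      have "g \<notin> carrier G" for g
      proof (induction "rank (x g)" arbitrary: g rule: less_induct)
        case less
        then show ?case using step[of g] S(2) by (meson m_closed subsetD)
      qed
      then show False using one_closed by blast
    qed
  next
    fix F assume F: "finite F" "F \<subseteq> carrier G"
    \<comment> \<open>For \<open>g\<close> in \<open>F\<close>, \<open>d g\<close> is the least
      number of letters leading out of \<open>F\<close>; the first letter of a shortest such word is
      a direction in which \<open>d\<close> decreases.\<close>
    define d where "d g = (LEAST k. \<exists>w\<in>lists S. length w = k \<and> walk g w \<notin> F)" for g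
    have "\<exists>s\<in>S. d (g \<otimes> s) < d g" if g: "g \<in> F" for g
    proof -
      have "\<exists>k. \<exists>w\<in>lists S. length w = k \<and> walk g w \<notin> F"
        using walk_leaves_finite[OF S(2,3) F(1), of g] g F(2) by blast
      then have "\<exists>w\<in>lists S. length w = d g \<and> walk g w \<notin> F"
        unfolding d_def by (rule LeastI_ex)
      then obtain w where w: "w \<in> lists S" "length w = d g" "walk g w \<notin> F" by blast
      with g obtain s v where "w = s # v" by (cases w) auto
      with w have v: "s \<in> S" "v \<in> lists S" "Suc (length v) = d g" "walk (g \<otimes> s) v \<notin> F"
        by auto
      then have "d (g \<otimes> s) \<le> length v" unfolding d_def by (intro Least_le) blast
      with v show ?thesis by (intro bexI[of _ s]) simp_all
    qed
    then obtain p where p: "\<And>g. g \<in> F \<Longrightarrow> p g \<in> S" "\<And>g. g \<in> F \<Longrightarrow> d (g \<otimes> p g) < d g"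
      by metis
    have "S \<noteq> {}" using S(3) by auto
    then obtain s0 where s0: "s0 \<in> S" by blast
    \<comment> \<open>Outside \<open>F\<close> the direction is arbitrary in \<open>S\<close>; being
      in \<open>S\<close> makes the rank decode to \<open>d g\<close> there too, where tests inside
      \<open>F\<close> may read it.\<close>
    define x where "x = (\<lambda>g\<in>carrier G. emb (d g, if g \<in> F then p g else s0))"
    have x: "x \<in> configs G A" using emb by (auto simp: x_def)
    have x_rank: "rank (x g) = d g" if "g \<in> carrier G" for g
      using that p s0 by (auto simp: x_def rd)
    have "\<tau> x g = y g" if g: "g \<in> F" for g
    proof -
      have "g \<in> carrier G" "g \<otimes> p g \<in> carrier G" using g F p S(2) by blast+
      moreover from this have "dir (x g) = p g" using g p by (simp add: x_def rd)
      ultimately show ?thesis using \<tau>[of g x] p[OF g] by (simp add: x_rank y_def)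
    qed
    moreover have "\<tau> x \<in> configs G A" using ca x by (auto simp: cellular_automaton_def)
    ultimately show "\<exists>z\<in>\<tau> ` configs G A. z \<in> configs G A \<and> (\<forall>g\<in>F. z g = y g)"
      using x by (intro bexI[of _ "\<tau> x"] conjI ballI imageI)
  qed
  with ca show ?thesis by (intro exI conjI)
qed

end

section \<open>Infinite-dimensional vector spaces and linear automata\<close>

lemma vector_space_infinite_basis:
  assumes "infinite_dimensional smul"
  obtains B where "\<not> module.dependent smul B" "module.span smul B = UNIV" "infinite B"
proof -
  interpret vector_space smul using assms by (simp add: infinite_dimensional_def)
  define B where "B = extend_basis {}"
  have B: "independent B" "span B = UNIV"
    using independent_extend_basis[OF independent_empty] span_extend_basis[OF independent_empty]
    by (simp_all add: B_def)
  have "infinite B"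
  proof
    assume "finite B"
    then have "finite_dimensional_vector_space smul B"
      using B by unfold_locales
    with assms show False by (auto simp: infinite_dimensional_def)
  qed
  with B show ?thesis using that by blast
qed

lemma (in group) ex_linear_cellular_automaton_image_not_closed:
  fixes smul :: "'k::field \<Rightarrow> 'v::ab_group_add \<Rightarrow> 'v"
  assumes "\<not> locally_finite_group G" "infinite_dimensional smul"
  shows "\<exists>\<tau>. linear_cellular_automaton G smul \<tau> \<and>
    \<not> closedin (prodiscrete_topology G (UNIV :: 'v set)) (\<tau> ` configs G UNIV)"
proof -
  interpret vector_space smul using assms by (simp add: infinite_dimensional_def)
  interpret vp: vector_space_pair smul smul by unfold_locales
  obtain S where S: "finite S" "S \<subseteq> carrier G" "infinite (walk \<one> ` lists S)"
    using infinite_walks[OF assms(1)] .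
  obtain B where B: "independent B" "span B = UNIV" "infinite B"
    using vector_space_infinite_basis[OF assms(2)] .
  obtain b :: "nat \<Rightarrow> 'v" where b: "inj b" "range b \<subseteq> B"
    using infinite_countable_subset[OF B(3)] by blast
  \<comment> \<open>\<open>prod_encode\<close> splits the countable family \<open>b\<close> into
    infinitely many disjoint chains, one for each word.\<close>
  define e where "e n i = b (prod_encode (n, i))" for n i
  have e_eq: "e n i = e m j \<longleftrightarrow> n = m \<and> i = j" for n i m j
    using b(1) by (auto simp: e_def inj_eq)
  have e_B: "e n i \<in> B" for n i using b(2) by (auto simp: e_def)
  obtain h :: "nat \<Rightarrow> 'a" where h: "inj h" "range h \<subseteq> walk \<one> ` lists S"
    using infinite_countable_subset[OF S(3)] by blast
  then have "\<forall>n. \<exists>w\<in>lists S. h n = walk \<one> w" by blast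
  then obtain w where w: "\<And>n. w n \<in> lists S" "\<And>n. h n = walk \<one> (w n)" by metis
  define L where "L n = length (w n)" for n
  define p where "p n i = walk \<one> (take i (w n))" for n i
  have w_S: "w n ! i \<in> S" if "i < L n" for n i using w(1)[of n] that by (auto simp: L_def)
  have p_carrier: "p n i \<in> carrier G" for n i
  proof -
    have "set (take i (w n)) \<subseteq> carrier G"
      using set_take_subset[of i "w n"] w(1)[of n] S(2) by auto
    then show ?thesis by (simp add: p_def walk_closed)
  qed
  have p_0: "p n 0 = \<one>" and p_L: "p n (L n) = h n" for n by (simp_all add: p_def L_def w)
  have p_Suc: "p n (Suc i) = p n i \<otimes> w n ! i" if "i < L n" for n i
    using that by (simp add: p_def L_def take_Suc_conv_app_nth)

  \<comment> \<open>The \<open>THE\<close> is well defined since chain vectors are pairwise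
    distinct. The bottoms \<open>e n 0\<close>, the vectors \<open>e n j\<close> with
    \<open>j > L n\<close> and the basis vectors off the chains go to 0.\<close>
  define T where "T s = vp.construct B (\<lambda>v. if \<exists>n i. v = e n (Suc i) \<and> i < L n \<and> w n ! i = s
    then (THE u. \<exists>n i. v = e n (Suc i) \<and> u = e n i) else 0)" for s
  have T_lin: "Vector_Spaces.linear smul smul (T s)" for s
    unfolding T_def by (rule vp.linear_construct[OF B(1)])
  have T_add: "T s (u + v) = T s u + T s v" and T_scale: "T s (smul c v) = smul c (T s v)"
    and T_0: "T s 0 = 0" and T_sum: "T s (sum f I) = (\<Sum>i\<in>I. T s (f i))" for s u v c f and I :: "nat set"
    using vp.linear_add[OF T_lin] vp.linear_scale[OF T_lin] vp.linear_0[OF T_lin]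
      vp.linear_sum[OF T_lin] by blast+
  have T_basis: "T s v = (if \<exists>n i. v = e n (Suc i) \<and> i < L n \<and> w n ! i = s
    then (THE u. \<exists>n i. v = e n (Suc i) \<and> u = e n i) else 0)" if "v \<in> B" for s v
    unfolding T_def by (rule vp.construct_basis[OF B(1) that])
  have T_e_Suc: "T s (e n (Suc i)) = (if i < L n \<and> w n ! i = s then e n i else 0)" for s n i
    by (simp add: T_basis e_B e_eq)
  have T_e_0: "T s (e n 0) = 0" for s n
    by (simp add: T_basis e_B e_eq)
  have T_other: "T s v = 0" if "v \<in> B" "\<And>n i. v \<noteq> e n (Suc i)" for s v
    using that by (simp add: T_basis)
  define \<phi> where "\<phi> n i v = representation B v (e n i)" for n i v
  have \<phi>_add: "\<phi> n i (u + v) = \<phi> n i u + \<phi> n i v"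
    and \<phi>_scale: "\<phi> n i (smul c v) = c * \<phi> n i v" and \<phi>_0: "\<phi> n i 0 = 0"
    and \<phi>_diff: "\<phi> n i (u - v) = \<phi> n i u - \<phi> n i v"
    and \<phi>_sum: "\<phi> n i (sum f S) = (\<Sum>s\<in>S. \<phi> n i (f s))" for n i u v c and f :: "'a \<Rightarrow> 'v"
    by (simp_all add: \<phi>_def B representation_add representation_scale representation_diff
        representation_zero representation_sum)
  have \<phi>_basis: "\<phi> n i v = (if v = e n i then 1 else 0)" if "v \<in> B" for n i v
    using that by (simp add: \<phi>_def B representation_basis)
  \<comment> \<open>Dual form of \<open>T s\<close>: a coordinate of the image is read one place
    higher in the chain. By linearity it suffices to check basis vectors.\<close>
  have \<phi>_T: "\<phi> n i (T s v) = (if i < L n \<and> w n ! i = s then \<phi> n (Suc i) v else 0)" for n i s v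
  proof -
    have "v \<in> span B" using B(2) by simp
    then show ?thesis
    proof (induction rule: span_induct_alt)
      case base
      then show ?case by (simp add: T_0 \<phi>_0)
    next
      case (step c u v)
      have "\<phi> n i (T s u) = (if i < L n \<and> w n ! i = s then \<phi> n (Suc i) u else 0)"
      proof (cases "\<exists>m j. u = e m (Suc j)")
        case True
        then show ?thesis by (auto simp: T_e_Suc \<phi>_basis e_B e_eq \<phi>_0)
      next
        case False
        with step(1) show ?thesis by (auto simp: T_other \<phi>_0 \<phi>_basis)
      qed
      with step(2) show ?case by (simp add: T_add T_scale \<phi>_add \<phi>_scale)
    qed
  qed

  define M where "M = insert \<one> S"
  define \<mu> where "\<mu> y = y \<one> - (\<Sum>s\<in>S. T s (y s))" for y
  define \<tau> where "\<tau> = induced_map M \<mu>"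
  have M: "finite M" "M \<subseteq> carrier G" "\<mu> \<in> (M \<rightarrow>\<^sub>E UNIV) \<rightarrow> UNIV"
    using S by (auto simp: M_def)
  have "linear_on_power smul M \<mu>"
    by (simp add: linear_on_power_def \<mu>_def M_def T_add T_scale sum.distrib scale_sum_right
        scale_right_diff_distrib)
  then have ca: "linear_cellular_automaton G smul \<tau>"
    using induced_map[OF M] by (auto simp: linear_cellular_automaton_def \<tau>_def)
  have \<tau>: "\<tau> x g = x g - (\<Sum>s\<in>S. T s (x (g \<otimes> s)))" if "g \<in> carrier G" for x g
    using that by (auto simp: \<tau>_def induced_map_def \<mu>_def M_def)

  define y where "y = (\<lambda>g\<in>carrier G. if g \<in> range h then e (inv_into UNIV h g) (L (inv_into UNIV h g)) else 0)"
  have "\<not> closedin (prodiscrete_topology G UNIV) (\<tau> ` configs G UNIV)"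
  proof (rule not_closedin_prodiscreteI)
    show "y \<in> configs G UNIV" by (auto simp: y_def)
    show "y \<notin> \<tau> ` configs G UNIV"
    proof
      assume "y \<in> \<tau> ` configs G UNIV"
      then obtain x where x: "y = \<tau> x" by blast
      have rec: "\<phi> n i (x g) = \<phi> n i (y g) + (if i < L n then \<phi> n (Suc i) (x (g \<otimes> w n ! i)) else 0)"
        if g: "g \<in> carrier G" for n i g
      proof -
        have "\<phi> n i (y g) = \<phi> n i (x g)
            - (\<Sum>s\<in>S. if i < L n \<and> w n ! i = s then \<phi> n (Suc i) (x (g \<otimes> s)) else 0)"
          unfolding x \<tau>[OF g] \<phi>_diff \<phi>_sum \<phi>_T ..
        \<comment> \<open>Only the letter \<open>w n ! i\<close> contributes to coordinate
          \<open>i\<close> of chain \<open>n\<close>.\<close>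
        also have "(\<Sum>s\<in>S. if i < L n \<and> w n ! i = s then \<phi> n (Suc i) (x (g \<otimes> s)) else 0)
            = (if i < L n then \<phi> n (Suc i) (x (g \<otimes> w n ! i)) else 0)"
          using S(1) w_S[of i n] by (cases "i < L n") simp_all
        finally show ?thesis by simp
      qed
      \<comment> \<open>The induction runs backwards from the end of the word. At the top,
        \<open>y\<close> supplies 1 and nothing is transported; below it \<open>y\<close>
        contributes 0, since its values are chain tops or zero.\<close>
      have "\<phi> n (L n - k) (x (p n (L n - k))) = 1" if "k \<le> L n" for n k
        using that
      proof (induction k)
        case 0
        have "h n \<in> carrier G" using p_carrier[of n "L n"] by (simp add: p_L)
        then show ?case
          using h(1) by (simp add: rec p_L y_def \<phi>_basis e_B)
      next
        case (Suc k)
        define i where "i = L n - Suc k"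
        have i: "i < L n" "L n - k = Suc i" using Suc.prems by (auto simp: i_def)
        have "\<phi> n i (y g) = 0" if "g \<in> carrier G" for g
          using i(1) that by (auto simp: y_def \<phi>_basis e_B e_eq \<phi>_0)
        with Suc i show ?case
          by (simp add: rec p_carrier p_Suc flip: i_def)
      qed
      from this[OF order_refl] have "\<phi> n 0 (x \<one>) = 1" for n by (simp add: p_0)
      \<comment> \<open>Infinitely many basis vectors \<open>e n 0\<close> would occur in the
        expansion of the single vector \<open>x \<one>\<close>.\<close>
      then have "range (\<lambda>n. e n 0) \<subseteq> {v. representation B (x \<one>) v \<noteq> 0}"
        by (auto simp: \<phi>_def)
      then have "finite (range (\<lambda>n. e n 0))"
        using finite_representation finite_subset by blast
      then show False
        by (auto dest!: finite_imageD simp: inj_on_def e_eq)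
    qed
  next
    fix F assume F: "finite F" "F \<subseteq> carrier G"
    define N where "N = h -` F"
    have N: "finite N" unfolding N_def by (rule finite_vimageI[OF F(1) h(1)])
    \<comment> \<open>Each chain with index in \<open>N\<close> is laid along its walk. Conditional
      sums are used because a walk may revisit a position and several walks may meet there.\<close>
    define x where "x = (\<lambda>g\<in>carrier G. \<Sum>n\<in>N. \<Sum>i\<le>L n. if g = p n i then e n i else 0)"
    have "\<tau> x g = y g" if "g \<in> F" for g
    proof -
      have g: "g \<in> carrier G" using that F by blast
      have T_term: "T s (\<Sum>i\<le>L n. if g \<otimes> s = p n i then e n i else 0)
          = (\<Sum>i<L n. if w n ! i = s then if g = p n i then e n i else 0 else 0)" if s: "s \<in> S" for s n
      proof -
        have *: "g \<otimes> s = p n (Suc i) \<longleftrightarrow> g = p n i" if "i < L n" "w n ! i = s" for i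
          using that g s S(2) p_carrier by (auto simp: p_Suc)
        have "T s (\<Sum>i\<le>L n. if g \<otimes> s = p n i then e n i else 0)
          = (\<Sum>i\<le>L n. if g \<otimes> s = p n i then T s (e n i) else 0)"
          by (simp add: T_sum if_distrib[of "T s"] T_0 cong: if_cong)
        \<comment> \<open>As \<open>T s\<close> kills \<open>e n 0\<close>, the sum can start at
          index 1 and be shifted down by one.\<close>
        also have "\<dots> = (\<Sum>i<L n. if g \<otimes> s = p n (Suc i) then T s (e n (Suc i)) else 0)"
          by (simp add: lessThan_Suc_atMost[symmetric] sum.lessThan_Suc_shift T_e_0 del: sum.lessThan_Suc)
        also have "\<dots> = (\<Sum>i<L n. if w n ! i = s then if g = p n i then e n i else 0 else 0)"
          by (rule sum.cong) (auto simp: T_e_Suc *)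
        finally show ?thesis .
      qed
      have "(\<Sum>s\<in>S. T s (x (g \<otimes> s)))
          = (\<Sum>s\<in>S. \<Sum>n\<in>N. T s (\<Sum>i\<le>L n. if g \<otimes> s = p n i then e n i else 0))"
        using g S(2) by (intro sum.cong) (auto simp: x_def T_sum)
      also have "\<dots> = (\<Sum>s\<in>S. \<Sum>n\<in>N. \<Sum>i<L n. if w n ! i = s then if g = p n i then e n i else 0 else 0)"
        by (simp add: T_term)
      also have "\<dots> = (\<Sum>n\<in>N. \<Sum>i<L n. \<Sum>s\<in>S. if w n ! i = s then if g = p n i then e n i else 0 else 0)"
        by (subst sum.swap) (simp add: sum.swap[of _ S])
      also have "\<dots> = (\<Sum>n\<in>N. \<Sum>i<L n. if g = p n i then e n i else 0)"
        using S(1) by (intro sum.cong) (auto simp: w_S)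
      \<comment> \<open>The chains in \<open>x\<close> reach the index \<open>L n\<close>, the
        lowered ones stop before it, so only the tops survive the subtraction.\<close>
      finally have "\<tau> x g = (\<Sum>n\<in>N. if g = h n then e n (L n) else 0)"
        using g by (simp add: \<tau> x_def lessThan_Suc_atMost[symmetric] p_L sum.distrib)
      also have "\<dots> = y g"
      proof (cases "g \<in> range h")
        case True
        then obtain n where n: "g = h n" by blast
        \<comment> \<open>Membership of \<open>g\<close> in \<open>F\<close> puts its index into
          \<open>N\<close>; injectivity of \<open>h\<close> then leaves one term of the sum.\<close>
        then have "n \<in> N" using that by (simp add: N_def)
        with n N h(1) g show ?thesis by (simp add: inj_eq y_def)
      next
        case False
        then show ?thesis using g by (auto simp: y_def intro!: sum.neutral)
      qed
      finally show ?thesis .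
    qed
    moreover have "x \<in> configs G UNIV" by (auto simp: x_def)
    moreover from this have "\<tau> x \<in> configs G UNIV"
      using ca by (auto simp: linear_cellular_automaton_def)
    ultimately show "\<exists>z\<in>\<tau> ` configs G UNIV. z \<in> configs G UNIV \<and> (\<forall>g\<in>F. z g = y g)"
      by (intro bexI[of _ "\<tau> x"] conjI ballI imageI)
  qed
  with ca show ?thesis by (intro exI conjI)
qed

theorem theorem1p3:
  fixes G :: "('g, 'm) monoid_scheme"
  assumes "group G"
    and "\<not> locally_finite_group G"
  shows "(\<forall>A :: 'a set. infinite A \<longrightarrow>
            (\<exists>\<tau>. cellular_automaton G A \<tau> \<and>
                 \<not> closedin (prodiscrete_topology G A) (\<tau> ` configs G A))) \<and>
         (\<forall>smul :: 'k::field \<Rightarrow> 'v::ab_group_add \<Rightarrow> 'v.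
            vector_space smul \<longrightarrow> infinite_dimensional smul \<longrightarrow>
            (\<exists>\<tau>. linear_cellular_automaton G smul \<tau> \<and>
                 \<not> closedin (prodiscrete_topology G (UNIV :: 'v set)) (\<tau> ` configs G UNIV)))"
proof (intro conjI allI impI)
  fix A :: "'a set"
  assume "infinite A"
  then show "\<exists>\<tau>. cellular_automaton G A \<tau> \<and>
      \<not> closedin (prodiscrete_topology G A) (\<tau> ` configs G A)"
    by (rule group.ex_cellular_automaton_image_not_closed[OF assms])
next
  fix smul :: "'k \<Rightarrow> 'v \<Rightarrow> 'v"
  assume "infinite_dimensional smul"
  then show "\<exists>\<tau>. linear_cellular_automaton G smul \<tau> \<and>
      \<not> closedin (prodiscrete_topology G (UNIV :: 'v set)) (\<tau> ` configs G UNIV)"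
    by (rule group.ex_linear_cellular_automaton_image_not_closed[OF assms])
qed

end
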